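(* Let $T,d\ge 1$ be integers and, for each $i\in\{1,\dots,T\}$, let $f_i:\mathbb R^d\to\mathbb R$ be strongly convex and twice differentiable with Lipschitz continuous gradient, and let $\xi_i>0$ and $L_{f_i}>0$ be constants such that $\|\nabla f_i(u)-\nabla f_i(v)\|\le L_{f_i}\|u-v\|$ and $\xi_i I_d\le \nabla^2 f_i(u)\le L_{f_i} I_d$ for all $u,v\in\mathbb R^d$. Put $\bar L=\max_i L_{f_i}$. Let $\sigma>0$, and for every iteration index $t=0,1,2,\dots$ let $\bar m_{ij}^t$ ($i,j\in\{1,\dots,T\}$) be real numbers with $\bar m_{ij}^t\ge 0$ for all $i,j$ and $\sum_{j=1}^T\bar m_{ij}^t=1$ for all $i$. Starting from initial vectors $w_i^0\in\mathbb R^d$, define $$w_i^{t+1}=(1-\alpha\sigma)\,w_i^t+\alpha\sigma\sum_{j=1}^T\bar m_{ij}^t\,w_j^t-\alpha\nabla f_i(w_i^t),\qquad i=1,\dots,T,\ t\ge 0 .$$ Let $w_i^*\in\mathbb R^d$ denote the best coefficient of the label predictor for task $i$, and let $\tilde w_i^t=w_i^t-w_i^*$. Then $w_i^t$ is convergent if the step size $\alpha$ is chosen to satisfy $$0<\alpha<\frac{2}{2\sigma+\bar L}.$$ Specifically, $$\lim_{t\to\infty}\ \max_i\|\tilde w_i^{t}\|\ \le\ \frac{2\alpha\sigma\max_i\|w_i^*\|+\alpha\max_i\|\nabla f_i(w_i^* )\|}{1-(\bar\gamma+\alpha\sigma)},$$ where $\bar\gamma=\max_i\{|1-\alpha\sigma-\alpha\xi_i|,\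 |1-\alpha\sigma-\alpha L_{f_i}|\}$.
   Context: $\|\cdot\|$ is the Euclidean norm on $\mathbb R^d$, $I_d$ is the $d\times d$ identity matrix, and $A\le B$ for symmetric matrices means that $B-A$ is positive semidefinite. The maximum defining $\bar\gamma$ is over all $i\in\{1,\dots,T\}$ and over both listed quantities. The function $f_i$ is the cost function of the $i$-th of $T$ learning tasks (each task being to minimize $f_i$ over $\mathbb R^d$), and $w_i^t$ is the model parameter of task $i$ at iteration $t$. The coefficients $\bar m_{ij}^t$ (rescaled transfer coefficients from task $j$ to task $i$) may depend on $t$ and need not be symmetric in $i,j$. The vectors $w_i^*$ are fixed (independent of $t$); the paper describes them only as the best coefficients of the label predictor for task $i$ and does not state that $\nabla f_i(w_i^* )=0$.
   Formalization: With time-varying coefficients the iterates may oscillate, so neither w_i^t nor the maximal error need converge; the limit in the bound is replaced by the limsup, and convergence of w_i^t is asserted only when every coefficient m_ij^t converges as t tends to infinity. *)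

theory Defs
  imports "HOL-Analysis.Analysis"
begin

definition gradient :: "(real ^ 'd \<Rightarrow> real) \<Rightarrow> real ^ 'd \<Rightarrow> real ^ 'd"
  where "gradient f x = (THE g. GDERIV f x :> g)"

(* Meaningful only where f is twice differentiable; elsewhere the values of
   gradient and jacobian are unspecified. *)
definition hessian :: "(real ^ 'd \<Rightarrow> real) \<Rightarrow> real ^ 'd \<Rightarrow> real ^ 'd ^ 'd"
  where "hessian f x = jacobian (gradient f) (at x)"

definition twice_differentiable :: "(real ^ 'd \<Rightarrow> real) \<Rightarrow> bool"
  where "twice_differentiable f \<longleftrightarrow>
    (\<forall>x. f differentiable (at x)) \<and> (\<forall>x. gradient f differentiable (at x))"

definition strongly_convex :: "(real ^ 'd \<Rightarrow> real) \<Rightarrow> bool"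
  where "strongly_convex f \<longleftrightarrow>
    (\<exists>\<mu>>0. \<forall>x y. \<forall>t\<in>{0..1}.
       f ((1 - t) *\<^sub>R x + t *\<^sub>R y)
         \<le> (1 - t) * f x + t * f y - \<mu> / 2 * t * (1 - t) * (norm (x - y))\<^sup>2)"

(* As usual for real matrices, symmetry is part of the notion. *)
definition positive_semidefinite :: "real ^ 'd ^ 'd \<Rightarrow> bool"
  where "positive_semidefinite A \<longleftrightarrow> transpose A = A \<and> (\<forall>x. 0 \<le> x \<bullet> (A *v x))"

definition loewner_le :: "real ^ 'd ^ 'd \<Rightarrow> real ^ 'd ^ 'd \<Rightarrow> bool"
  where "loewner_le A B \<longleftrightarrow> positive_semidefinite (B - A)"

end

(* Each gradient step x \<mapsto> (1 - \<alpha>\<sigma>) x - \<alpha> \<nabla>f_i(x) has Lipschitz constant at most \<gamma>, because its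
   derivative is symmetric with spectrum between 1 - \<alpha>\<sigma> - \<alpha>L_i and 1 - \<alpha>\<sigma> - \<alpha>\<xi>_i; the averaging
   term adds at most \<alpha>\<sigma>. Hence every iteration contracts the norm max_i |U_i - V_i| by the factor
   q = \<gamma> + \<alpha>\<sigma> < 1. Comparing the iterates with wstar, which is moved by at most
   c = 2\<alpha>\<sigma> max|wstar| + \<alpha> max|\<nabla>f(wstar)|, gives a_{t+1} \<le> q a_t + c and so the limsup bound c / (1 - q).
   If the coefficients converge, comparing the sequence with its own shifts gives the same kind of
   recurrence with arbitrarily small c, so the sequence is Cauchy. *)

theory Submission
  imports Defs
begin

text \<open>Polarization: for \<open>u\<close> a positive multiple of \<open>A *v x\<close> with the
  length of \<open>x\<close>, the product \<open>u \<bullet> (A *v x)\<close> is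
  \<open>norm x * norm (A *v x)\<close>. By symmetry, four times this product is a difference of two
  values of the quadratic form, and the parallelogram law bounds that difference by
  \<open>4 * c\<close> times the squared norm of \<open>x\<close>.\<close>

lemma norm_symmetric_matrix_le:
  fixes A :: "real ^ 'n ^ 'n"
  assumes sym: "transpose A = A"
    and quad: "\<And>x. \<bar>x \<bullet> (A *v x)\<bar> \<le> c * (norm x)\<^sup>2"
  shows "norm (A *v x) \<le> c * norm x"
proof (cases "A *v x = 0")
  case True
  have "0 \<le> c * norm x"
  proof (cases "x = 0")
    case False
    then have "0 \<le> c"
      using quad[of x] abs_ge_zero[of "x \<bullet> (A *v x)"] by (smt (verit) mult_neg_pos zero_less_norm_iff zero_less_power)
    then show ?thesis by simp
  qed simp
  with True show ?thesis by simp
next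
  case False
  then have "x \<noteq> 0" by auto
  define u where "u = (norm x / norm (A *v x)) *\<^sub>R (A *v x)"
  have nu: "norm u = norm x" using False by (simp add: u_def)
  have swap: "x \<bullet> (A *v u) = u \<bullet> (A *v x)"
    using sym by (metis dot_lmul_matrix inner_commute transpose_matrix_vector)
  have "4 * (u \<bullet> (A *v x)) = (u + x) \<bullet> (A *v (u + x)) - (u - x) \<bullet> (A *v (u - x))"
    by (simp add: matrix_vector_right_distrib matrix_vector_mult_diff_distrib
        inner_add_left inner_add_right inner_diff_left inner_diff_right swap)
  also have "\<dots> \<le> c * (norm (u + x))\<^sup>2 + c * (norm (u - x))\<^sup>2"
    using quad[of "u + x"] quad[of "u - x"] by linarith
  also have "\<dots> = 4 * (c * (norm x)\<^sup>2)"
    using nu by (simp add: power2_norm_eq_inner inner_add_left inner_add_right inner_diff_left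
        inner_diff_right inner_commute norm_eq algebra_simps)
  finally have "u \<bullet> (A *v x) \<le> c * (norm x)\<^sup>2" by simp
  moreover have "u \<bullet> (A *v x) = norm x * norm (A *v x)"
    using False by (simp add: u_def dot_square_norm power2_eq_square)
  ultimately have "norm x * norm (A *v x) \<le> norm x * (c * norm x)"
    by (simp add: power2_eq_square algebra_simps)
  then show ?thesis using \<open>x \<noteq> 0\<close> by simp
qed

text \<open>Turns the Hessian hypotheses into the input of \<open>norm_symmetric_matrix_le\<close>:
  a bound on the quadratic form, together with symmetry, which passes to \<open>A\<close> because
  the identity is symmetric.\<close>

lemma loewner_le_scaled_identity:
  fixes A :: "real ^ 'n ^ 'n"
  shows "loewner_le (a *\<^sub>R mat 1) A \<longleftrightarrow>
      transpose A = A \<and> (\<forall>x. a * (norm x)\<^sup>2 \<le> x \<bullet> (A *v x))"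
    and "loewner_le A (a *\<^sub>R mat 1) \<longleftrightarrow>
      transpose A = A \<and> (\<forall>x. x \<bullet> (A *v x) \<le> a * (norm x)\<^sup>2)"
proof -
  have [simp]: "transpose (A - a *\<^sub>R mat 1) = transpose A - a *\<^sub>R mat 1"
    "transpose (a *\<^sub>R mat 1 - A) = a *\<^sub>R mat 1 - transpose A"
    by (auto simp: transpose_def vec_eq_iff mat_def)
  show "loewner_le (a *\<^sub>R mat 1) A \<longleftrightarrow>
      transpose A = A \<and> (\<forall>x. a * (norm x)\<^sup>2 \<le> x \<bullet> (A *v x))"
    "loewner_le A (a *\<^sub>R mat 1) \<longleftrightarrow>
      transpose A = A \<and> (\<forall>x. x \<bullet> (A *v x) \<le> a * (norm x)\<^sup>2)"
    by (simp_all add: loewner_le_def positive_semidefinite_def matrix_vector_mult_diff_rdistrib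
        scaleR_matrix_vector_assoc[symmetric] inner_diff_right power2_norm_eq_inner)
qed

text \<open>Mean value inequality: the derivative is symmetric with spectrum between
  \<open>b - a * u\<close> and \<open>b - a * l\<close>, so its operator norm is controlled by the
  larger absolute value. The triangle inequality alone would give
  \<open>\<bar>b\<bar> + a * u\<close>, too large for a contraction.\<close>

lemma gradient_step_lipschitz:
  fixes f :: "real ^ 'n \<Rightarrow> real"
  assumes diff: "\<And>x. gradient f differentiable (at x)"
    and lower: "\<And>x. loewner_le (l *\<^sub>R mat 1) (hessian f x)"
    and upper: "\<And>x. loewner_le (hessian f x) (u *\<^sub>R mat 1)"
    and "0 \<le> a"
  shows "norm ((b *\<^sub>R x - a *\<^sub>R gradient f x) - (b *\<^sub>R y - a *\<^sub>R gradient f y))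
           \<le> max \<bar>b - a * l\<bar> \<bar>b - a * u\<bar> * norm (x - y)"
proof (rule differentiable_bound[where S = UNIV and f' = "\<lambda>z h. b *\<^sub>R h - a *\<^sub>R (hessian f z *v h)"])
  let ?c = "max \<bar>b - a * l\<bar> \<bar>b - a * u\<bar>"
  fix z :: "real ^ 'n"
  have "(gradient f has_derivative (\<lambda>h. hessian f z *v h)) (at z)"
    using diff[of z] jacobian_works unfolding hessian_def by blast
  then show "((\<lambda>x. b *\<^sub>R x - a *\<^sub>R gradient f x) has_derivative
      (\<lambda>h. b *\<^sub>R h - a *\<^sub>R (hessian f z *v h))) (at z within UNIV)"
    by (auto intro!: derivative_eq_intros)
  define A where "A = b *\<^sub>R mat 1 - a *\<^sub>R hessian f z"
  have A: "A *v h = b *\<^sub>R h - a *\<^sub>R (hessian f z *v h)" for h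
    by (simp add: A_def matrix_vector_mult_diff_rdistrib scaleR_matrix_vector_assoc[symmetric])
  have H: "transpose (hessian f z) = hessian f z"
    "l * (norm h)\<^sup>2 \<le> h \<bullet> (hessian f z *v h)" "h \<bullet> (hessian f z *v h) \<le> u * (norm h)\<^sup>2" for h
    using lower[of z] upper[of z] by (auto simp: loewner_le_scaled_identity)
  have "transpose A = b *\<^sub>R mat 1 - a *\<^sub>R transpose (hessian f z)"
    by (auto simp: A_def transpose_def vec_eq_iff mat_def)
  then have "transpose A = A" by (simp add: H A_def)
  moreover have "\<bar>h \<bullet> (A *v h)\<bar> \<le> ?c * (norm h)\<^sup>2" for h
  proof -
    have eq: "h \<bullet> (A *v h) = b * (norm h)\<^sup>2 - a * (h \<bullet> (hessian f z *v h))"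
      by (simp add: A inner_diff_right power2_norm_eq_inner)
    have "a * (l * (norm h)\<^sup>2) \<le> a * (h \<bullet> (hessian f z *v h))"
      "a * (h \<bullet> (hessian f z *v h)) \<le> a * (u * (norm h)\<^sup>2)"
      using H \<open>0 \<le> a\<close> by (auto intro!: mult_left_mono)
    then have "h \<bullet> (A *v h) \<le> (b - a * l) * (norm h)\<^sup>2" "(b - a * u) * (norm h)\<^sup>2 \<le> h \<bullet> (A *v h)"
      unfolding eq by (simp_all add: algebra_simps)
    moreover have "(b - a * l) * (norm h)\<^sup>2 \<le> ?c * (norm h)\<^sup>2"
      by (rule mult_right_mono) auto
    moreover have "- ?c * (norm h)\<^sup>2 \<le> (b - a * u) * (norm h)\<^sup>2"
      by (rule mult_right_mono) auto
    ultimately show ?thesis by (simp only: abs_le_iff) linarith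
  qed
  ultimately have "norm (b *\<^sub>R h - a *\<^sub>R (hessian f z *v h)) \<le> ?c * norm h" for h
    using norm_symmetric_matrix_le[of A ?c h] by (simp add: A)
  then show "onorm (\<lambda>h. b *\<^sub>R h - a *\<^sub>R (hessian f z *v h)) \<le> ?c"
    by (rule onorm_le)
qed auto

lemma norm_convex_combination_le:
  fixes x :: "'i \<Rightarrow> 'a::real_normed_vector"
  assumes "\<And>j. j \<in> I \<Longrightarrow> 0 \<le> c j" "(\<Sum>j\<in>I. c j) = 1" "\<And>j. j \<in> I \<Longrightarrow> norm (x j) \<le> B"
  shows "norm (\<Sum>j\<in>I. c j *\<^sub>R x j) \<le> B"
proof -
  have "norm (\<Sum>j\<in>I. c j *\<^sub>R x j) \<le> (\<Sum>j\<in>I. c j * B)"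
    using assms by (intro sum_norm_le) (auto intro: mult_left_mono)
  also have "\<dots> = B" using assms(2) by (simp add: sum_distrib_right[symmetric])
  finally show ?thesis .
qed

text \<open>The constant \<open>c / (1 - q)\<close> is the fixed point of the map sending
  \<open>r\<close> to \<open>q * r + c\<close>, so the induction carries it along unchanged while
  the initial value is damped by \<open>q\<close>.\<close>

lemma affine_recurrence_bound:
  fixes x :: "nat \<Rightarrow> real"
  assumes step: "\<And>n. x (Suc n) \<le> q * x n + c" and q: "0 \<le> q" "q < 1" and "0 \<le> c"
  shows "x n \<le> q ^ n * x 0 + c / (1 - q)"
proof (induction n)
  case 0
  then show ?case using q \<open>0 \<le> c\<close> by simp
next
  case (Suc n)
  have "x (Suc n) \<le> q * (q ^ n * x 0 + c / (1 - q)) + c"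
    using step[of n] mult_left_mono[OF Suc q(1)] by linarith
  also have "\<dots> = q ^ Suc n * x 0 + c / (1 - q)"
    using q by (simp add: field_simps)
  finally show ?case .
qed

text \<open>Time-varying weights can keep the iterates oscillating: for two quadratics on the line
  with opposite minimizers and opposite starting points, weights alternating between identity and
  swap alternate two affine contractions with different fixed points. Hence the bound is on a
  limsup, and convergence is tied to convergent coefficients.\<close>

theorem theorem1:
  fixes T :: nat
    and f :: "nat \<Rightarrow> real ^ 'd \<Rightarrow> real"
    and \<xi> L :: "nat \<Rightarrow> real"
    and \<sigma> \<alpha> Lbar \<gamma> :: real
    and m :: "nat \<Rightarrow> nat \<Rightarrow> nat \<Rightarrow> real"
    and w :: "nat \<Rightarrow> nat \<Rightarrow> real ^ 'd"
    and wstar :: "nat \<Rightarrow> real ^ 'd"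
  assumes T: "1 \<le> T"
    and convex: "\<And>i. i \<in> {1..T} \<Longrightarrow> strongly_convex (f i)"
    and diff: "\<And>i. i \<in> {1..T} \<Longrightarrow> twice_differentiable (f i)"
    and xi_pos: "\<And>i. i \<in> {1..T} \<Longrightarrow> 0 < \<xi> i"
    and L_pos: "\<And>i. i \<in> {1..T} \<Longrightarrow> 0 < L i"
    and lipschitz: "\<And>i u v. i \<in> {1..T} \<Longrightarrow>
          norm (gradient (f i) u - gradient (f i) v) \<le> L i * norm (u - v)"
    and hessian_ge: "\<And>i u. i \<in> {1..T} \<Longrightarrow> loewner_le (\<xi> i *\<^sub>R mat 1) (hessian (f i) u)"
    and hessian_le: "\<And>i u. i \<in> {1..T} \<Longrightarrow> loewner_le (hessian (f i) u) (L i *\<^sub>R mat 1)"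
    and Lbar: "Lbar = (MAX i\<in>{1..T}. L i)"
    and sigma_pos: "0 < \<sigma>"
    and m_nonneg: "\<And>t i j. i \<in> {1..T} \<Longrightarrow> j \<in> {1..T} \<Longrightarrow> 0 \<le> m t i j"
    and m_sum: "\<And>t i. i \<in> {1..T} \<Longrightarrow> (\<Sum>j=1..T. m t i j) = 1"
    and iteration: "\<And>t i. i \<in> {1..T} \<Longrightarrow>
          w (Suc t) i = (1 - \<alpha> * \<sigma>) *\<^sub>R w t i
            + (\<alpha> * \<sigma>) *\<^sub>R (\<Sum>j=1..T. m t i j *\<^sub>R w t j)
            - \<alpha> *\<^sub>R gradient (f i) (w t i)"
    and step_size: "0 < \<alpha>" "\<alpha> < 2 / (2 * \<sigma> + Lbar)"
    and gamma: "\<gamma> = (MAX i\<in>{1..T}.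
          max \<bar>1 - \<alpha> * \<sigma> - \<alpha> * \<xi> i\<bar> \<bar>1 - \<alpha> * \<sigma> - \<alpha> * L i\<bar>)"
  shows "limsup (\<lambda>t. ereal (MAX i\<in>{1..T}. norm (w t i - wstar i)))
           \<le> ereal ((2 * \<alpha> * \<sigma> * (MAX i\<in>{1..T}. norm (wstar i))
                     + \<alpha> * (MAX i\<in>{1..T}. norm (gradient (f i) (wstar i))))
                    / (1 - (\<gamma> + \<alpha> * \<sigma>)))
       \<and> ((\<forall>i\<in>{1..T}. \<forall>j\<in>{1..T}. convergent (\<lambda>t. m t i j))
            \<longrightarrow> (\<forall>i\<in>{1..T}. convergent (\<lambda>t. w t i)))"
proof -

  \<comment> \<open>The contraction factor\<close>
  let ?I = "{1..T}"
  define q where "q = \<gamma> + \<alpha> * \<sigma>"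
  \<comment> \<open>One iteration of task \<open>i\<close> on an arbitrary family \<open>U\<close>.
    The weights are a separate argument, so that two families can be compared under the same
    weights.\<close>
  define S where "S p i U = (1 - \<alpha> * \<sigma>) *\<^sub>R U i + (\<alpha> * \<sigma>) *\<^sub>R (\<Sum>j=1..T. p j *\<^sub>R U j)
      - \<alpha> *\<^sub>R gradient (f i) (U i)" for p :: "nat \<Rightarrow> real" and i and U :: "nat \<Rightarrow> real ^ 'd"
  have ne: "?I \<noteq> {}" using T by auto
  have as: "0 < \<alpha> * \<sigma>" using sigma_pos step_size by simp
  have tri: "norm (x + (\<alpha> * \<sigma>) *\<^sub>R y) \<le> norm x + \<alpha> * \<sigma> * norm y" for x y :: "real ^ 'd"
    using norm_triangle_ineq[of x "(\<alpha> * \<sigma>) *\<^sub>R y"] unfolding norm_scaleR abs_of_pos[OF as] .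
  have MaxI: "g i \<le> (MAX i\<in>?I. g i)" if "i \<in> ?I" for g :: "nat \<Rightarrow> real" and i
    using that by simp
  have MaxE: "(MAX i\<in>?I. g i) \<le> B" if "\<And>i. i \<in> ?I \<Longrightarrow> g i \<le> B" for g :: "nat \<Rightarrow> real" and B
    using that ne by (subst Max_le_iff) auto
  \<comment> \<open>Both Hessian bounds are tested on a single unit vector; which coordinate axis
    and which base point are used is immaterial.\<close>
  have xi_le_L: "\<xi> i \<le> L i" if i: "i \<in> ?I" for i
  proof -
    define e :: "real ^ 'd" where "e = axis undefined 1"
    have "norm e = 1" by (simp add: e_def)
    then show ?thesis
      using hessian_ge[OF i, of 0] hessian_le[OF i, of 0] unfolding loewner_le_scaled_identity
      by (metis mult.right_neutral order_trans power_one)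
  qed
  have gam_i: "max \<bar>1 - \<alpha> * \<sigma> - \<alpha> * \<xi> i\<bar> \<bar>1 - \<alpha> * \<sigma> - \<alpha> * L i\<bar> \<le> \<gamma>" if "i \<in> ?I" for i
    unfolding gamma using that by (rule MaxI)
  have gam0: "0 \<le> \<gamma>" using gam_i[of 1] T by auto
  have q0: "0 \<le> q" using gam0 as by (simp add: q_def)
  have "0 < L 1" using L_pos T by simp
  also have "L 1 \<le> Lbar" unfolding Lbar using T by (intro MaxI) simp
  finally have "0 < 2 * \<sigma> + Lbar" using sigma_pos by simp
  then have aL: "\<alpha> * (2 * \<sigma> + Lbar) < 2" using step_size by (simp add: field_simps)
  \<comment> \<open>For \<open>x\<close> equal to \<open>\<xi> i\<close> or \<open>L i\<close>, the
    upper side of the absolute value needs \<open>0 < \<alpha> * x\<close>. The lower side needs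
    \<open>\<alpha> * x < 2 - 2 * \<alpha> * \<sigma>\<close>, which is where the step size
    condition enters.\<close>
  have "\<gamma> < 1 - \<alpha> * \<sigma>"
    unfolding gamma
  proof (subst Max_less_iff)
    show "\<forall>a\<in>(\<lambda>i. max \<bar>1 - \<alpha> * \<sigma> - \<alpha> * \<xi> i\<bar> \<bar>1 - \<alpha> * \<sigma> - \<alpha> * L i\<bar>) ` ?I. a < 1 - \<alpha> * \<sigma>"
    proof (clarify)
      fix i assume i: "i \<in> ?I"
      have "L i \<le> Lbar" unfolding Lbar using i by (rule MaxI)
      then have "\<alpha> * L i \<le> \<alpha> * Lbar" "\<alpha> * \<xi> i \<le> \<alpha> * L i" "0 < \<alpha> * \<xi> i"
        using step_size xi_le_L[OF i] xi_pos[OF i] by auto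
      then show "max \<bar>1 - \<alpha> * \<sigma> - \<alpha> * \<xi> i\<bar> \<bar>1 - \<alpha> * \<sigma> - \<alpha> * L i\<bar> < 1 - \<alpha> * \<sigma>"
        using aL by (simp add: algebra_simps abs_less_iff)
    qed
  qed (use ne in auto)
  then have q1: "q < 1" by (simp add: q_def)

  \<comment> \<open>One iteration contracts the maximum norm\<close>
  have contr: "norm (S p i U - S p i V) \<le> q * B"
    if i: "i \<in> ?I" and p: "\<And>j. j \<in> ?I \<Longrightarrow> 0 \<le> p j" "(\<Sum>j=1..T. p j) = 1"
      and B: "\<And>j. j \<in> ?I \<Longrightarrow> norm (U j - V j) \<le> B" for p i U V B
  proof -
    let ?g = "\<lambda>x. (1 - \<alpha> * \<sigma>) *\<^sub>R x - \<alpha> *\<^sub>R gradient (f i) x"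
    have eq: "S p i U - S p i V
        = (?g (U i) - ?g (V i)) + (\<alpha> * \<sigma>) *\<^sub>R (\<Sum>j=1..T. p j *\<^sub>R (U j - V j))"
      unfolding S_def scaleR_diff_right sum_subtractf by simp
    have "norm (S p i U - S p i V) \<le> norm (?g (U i) - ?g (V i))
        + \<alpha> * \<sigma> * norm (\<Sum>j=1..T. p j *\<^sub>R (U j - V j))"
      unfolding eq by (rule tri)
    \<comment> \<open>The averaging term obeys the same bound \<open>B\<close> as the single task
      because the weights form a convex combination; this is why the maximum over tasks is the
      suitable norm.\<close>
    also have "\<dots> \<le> \<gamma> * B + \<alpha> * \<sigma> * B"
    proof (rule add_mono)
      have "norm (?g (U i) - ?g (V i))
          \<le> max \<bar>1 - \<alpha> * \<sigma> - \<alpha> * \<xi> i\<bar> \<bar>1 - \<alpha> * \<sigma> - \<alpha> * L i\<bar> * norm (U i - V i)"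
        using diff[OF i] hessian_ge[OF i] hessian_le[OF i] step_size
        by (intro gradient_step_lipschitz) (auto simp: twice_differentiable_def)
      also have "\<dots> \<le> \<gamma> * B"
        using gam_i[OF i] B[OF i] gam0 by (intro mult_mono) auto
      finally show "norm (?g (U i) - ?g (V i)) \<le> \<gamma> * B" .
      show "\<alpha> * \<sigma> * norm (\<Sum>j=1..T. p j *\<^sub>R (U j - V j)) \<le> \<alpha> * \<sigma> * B"
        using norm_convex_combination_le[of ?I p "\<lambda>j. U j - V j" B] p B as
        by (intro mult_left_mono) auto
    qed
    finally show ?thesis by (simp add: q_def algebra_simps)
  qed
  have w_Suc: "w (Suc t) i = S (m t i) i (w t)" if "i \<in> ?I" for t i
    using iteration[OF that, of t] by (simp add: S_def)

  \<comment> \<open>Distance of the iterates from \<open>wstar\<close>\<close>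
  define W where "W = (MAX i\<in>?I. norm (wstar i))"
  define G where "G = (MAX i\<in>?I. norm (gradient (f i) (wstar i)))"
  define c where "c = 2 * \<alpha> * \<sigma> * W + \<alpha> * G"
  define a where "a t = (MAX i\<in>?I. norm (w t i - wstar i))" for t
  have Wi: "norm (wstar i) \<le> W" and Gi: "norm (gradient (f i) (wstar i)) \<le> G"
    and ai: "norm (w t i - wstar i) \<le> a t" if "i \<in> ?I" for i t
    unfolding W_def G_def a_def using that by (auto intro: MaxI)
  have one: "1 \<in> ?I" using T by simp
  have W0: "0 \<le> W" and G0: "0 \<le> G" and a0: "0 \<le> a t" for t
    using Wi[OF one] Gi[OF one] ai[OF one, of t] norm_ge_zero order_trans by blast+
  have c0: "0 \<le> c" unfolding c_def using W0 G0 step_size sigma_pos by simp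
  have a_Suc: "a (Suc t) \<le> q * a t + c" for t
    unfolding a_def[of "Suc t"]
  proof (rule MaxE)
    fix i assume i: "i \<in> ?I"
    let ?s = "\<Sum>j=1..T. m t i j *\<^sub>R wstar j"
    \<comment> \<open>\<open>wstar\<close> need not be fixed by the iteration: the second bracket is
      its displacement in one step. The term \<open>?s - wstar i\<close> has norm at most
      \<open>W + W\<close>, the source of the factor 2 in \<open>c\<close>.\<close>
    have eq: "w (Suc t) i - wstar i = (S (m t i) i (w t) - S (m t i) i wstar)
        + ((\<alpha> * \<sigma>) *\<^sub>R (?s - wstar i) - \<alpha> *\<^sub>R gradient (f i) (wstar i))"
      unfolding w_Suc[OF i] S_def scaleR_diff_right scaleR_diff_left by simp
    have "norm (w (Suc t) i - wstar i) \<le> norm (S (m t i) i (w t) - S (m t i) i wstar)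
        + (norm ((\<alpha> * \<sigma>) *\<^sub>R (?s - wstar i)) + norm (\<alpha> *\<^sub>R gradient (f i) (wstar i)))"
      unfolding eq by (rule order_trans[OF norm_triangle_ineq add_left_mono[OF norm_triangle_ineq4]])
    also have "\<dots> \<le> q * a t + (\<alpha> * \<sigma> * (W + W) + \<alpha> * G)"
    proof (intro add_mono)
      show "norm (S (m t i) i (w t) - S (m t i) i wstar) \<le> q * a t"
        by (rule contr[OF i m_nonneg[OF i] m_sum[OF i] ai])
      have "norm ?s \<le> W"
        by (rule norm_convex_combination_le[OF m_nonneg[OF i] m_sum[OF i] Wi])
      then have "norm (?s - wstar i) \<le> W + W"
        using Wi[OF i] norm_triangle_ineq4[of ?s "wstar i"] by linarith
      then show "norm ((\<alpha> * \<sigma>) *\<^sub>R (?s - wstar i)) \<le> \<alpha> * \<sigma> * (W + W)"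
        unfolding norm_scaleR abs_of_pos[OF as] using as by (intro mult_left_mono) auto
      show "norm (\<alpha> *\<^sub>R gradient (f i) (wstar i)) \<le> \<alpha> * G"
        using Gi[OF i] step_size by simp
    qed
    finally show "norm (w (Suc t) i - wstar i) \<le> q * a t + c"
      by (simp add: c_def algebra_simps)
  qed
  note a_le = affine_recurrence_bound[of a, OF a_Suc q0 q1 c0]

  \<comment> \<open>The limsup bound\<close>
  have "limsup (\<lambda>t. ereal (a t)) \<le> limsup (\<lambda>t. ereal (q ^ t * a 0 + c / (1 - q)))"
    using a_le by (intro Limsup_mono) auto
  also have "\<dots> = ereal (c / (1 - q))"
  proof (rule lim_imp_Limsup)
    have "(\<lambda>t. q ^ t * a 0 + c / (1 - q)) \<longlonglongrightarrow> 0 * a 0 + c / (1 - q)"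
      using q0 q1 by (intro tendsto_intros LIMSEQ_realpow_zero)
    then show "(\<lambda>t. ereal (q ^ t * a 0 + c / (1 - q))) \<longlonglongrightarrow> ereal (c / (1 - q))"
      by simp
  qed simp
  finally have part1: "limsup (\<lambda>t. ereal (a t)) \<le> ereal (c / (1 - q))" .

  \<comment> \<open>Convergence of the iterates for convergent coefficients\<close>
  have part2: "\<forall>i\<in>?I. convergent (\<lambda>t. w t i)"
    if conv: "\<forall>i\<in>?I. \<forall>j\<in>?I. convergent (\<lambda>t. m t i j)"
  proof -
    \<comment> \<open>A bound on all iterates, uniform in time; the summand 1 makes it strictly
      positive, so that \<open>K\<close> below can be divided by.\<close>
    define R where "R = a 0 + c / (1 - q) + W + 1"
    have R0: "0 < R" using a0[of 0] W0 c0 q1 by (simp add: R_def add_nonneg_pos)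
    have wR: "norm (w t i) \<le> R" if i: "i \<in> ?I" for t i
    proof -
      have "q ^ t * a 0 \<le> 1 * a 0"
        using q0 q1 a0 by (intro mult_right_mono power_le_one) auto
      then show ?thesis
        using ai[OF i, of t] a_le[of t] Wi[OF i] norm_triangle_sub[of "w t i" "wstar i"]
        unfolding R_def by linarith
    qed
    have cauchy: "\<exists>N. \<forall>i\<in>?I. \<forall>s\<ge>N. \<forall>k. norm (w (s + k) i - w s i) < e" if "0 < e" for e
    proof -
      \<comment> \<open>\<open>d\<close> is the tolerance for changes of the weights. It makes the
        error committed in each step \<open>e / 2 * (1 - q)\<close>, which accumulates to at most
        \<open>e / 2\<close> by \<open>affine_recurrence_bound\<close>.\<close>
      define K where "K = \<alpha> * \<sigma> * (real T * R)"
      define d where "d = e / 2 * (1 - q) / K"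
      have K0: "0 < K" using sigma_pos step_size R0 T unfolding K_def by (intro mult_pos_pos) auto
      have d0: "0 < d" unfolding d_def using \<open>0 < e\<close> q1 K0 by simp
      have "\<alpha> * \<sigma> * (real T * (d * R)) = d * K" by (simp add: K_def)
      then have dd: "\<alpha> * \<sigma> * (real T * (d * R)) = e / 2 * (1 - q)"
        using K0 by (simp add: d_def)
      obtain M where M: "\<forall>i\<in>?I. \<forall>j\<in>?I. (\<lambda>t. m t i j) \<longlonglongrightarrow> M i j"
        using conv unfolding convergent_def by metis
      \<comment> \<open>Half of \<open>d\<close> here, so that the weights at any two late times
        differ by at most \<open>d\<close>.\<close>
      have "\<forall>\<^sub>F t in sequentially. \<forall>i\<in>?I. \<forall>j\<in>?I. \<bar>m t i j - M i j\<bar> < d / 2"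
      proof (intro eventually_ball_finite ballI)
        fix i j assume "i \<in> ?I" "j \<in> ?I"
        then show "\<forall>\<^sub>F t in sequentially. \<bar>m t i j - M i j\<bar> < d / 2"
          using M d0 tendstoD[of "\<lambda>t. m t i j" "M i j" sequentially "d / 2"]
          by (simp add: dist_real_def)
      qed auto
      then obtain N where N: "\<And>t i j. N \<le> t \<Longrightarrow> i \<in> ?I \<Longrightarrow> j \<in> ?I \<Longrightarrow> \<bar>m t i j - M i j\<bar> < d / 2"
        unfolding eventually_sequentially by blast
      \<comment> \<open>The other half of \<open>e\<close> is for the initial gap between the
        sequence and its shift, at most \<open>2 * R\<close> and damped by \<open>q\<close> in each
        step.\<close>
      have "(\<lambda>n. q ^ n * (2 * R)) \<longlonglongrightarrow> 0 * (2 * R)"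
        using q0 q1 by (intro tendsto_intros LIMSEQ_realpow_zero)
      then have "\<forall>\<^sub>F n in sequentially. q ^ n * (2 * R) < e / 2"
        using \<open>0 < e\<close> by (intro order_tendstoD(2)[where y = 0]) auto
      then obtain n0 where n0: "\<And>n. n0 \<le> n \<Longrightarrow> q ^ n * (2 * R) < e / 2"
        unfolding eventually_sequentially by blast
      have bound: "norm (w (N + n + k) i - w (N + n) i) \<le> q ^ n * (2 * R) + e / 2"
        if i: "i \<in> ?I" for i n k
      proof -
        \<comment> \<open>Gap between the sequence started at \<open>N\<close> and its shift by the
          fixed \<open>k\<close>. The estimate obtained for it is independent of \<open>k\<close>,
          as the Cauchy property demands.\<close>
        define b where "b n = (MAX i\<in>?I. norm (w (N + n + k) i - w (N + n) i))" for n
        have bi: "norm (w (N + n + k) i - w (N + n) i) \<le> b n" if "i \<in> ?I" for i n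
          unfolding b_def using that by (rule MaxI)
        have b_Suc: "b (Suc n) \<le> q * b n + e / 2 * (1 - q)" for n
          unfolding b_def[of "Suc n"]
        proof (rule MaxE)
          fix i assume i: "i \<in> ?I"
          let ?t = "N + n"
          let ?D = "\<Sum>j=1..T. (m (?t + k) i j - m ?t i j) *\<^sub>R w ?t j"
          \<comment> \<open>The two steps use different weights, so \<open>contr\<close> does not
            apply directly. Both are performed with the later weights, and \<open>?D\<close>
            collects the effect of the change of weights on the unshifted iterate.\<close>
          have eq: "w (N + Suc n + k) i - w (N + Suc n) i
              = (S (m (?t + k) i) i (w (?t + k)) - S (m (?t + k) i) i (w ?t)) + (\<alpha> * \<sigma>) *\<^sub>R ?D"
            using w_Suc[OF i, of "?t + k"] w_Suc[OF i, of ?t]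
            unfolding S_def scaleR_diff_left sum_subtractf scaleR_diff_right by simp
          have "norm (w (N + Suc n + k) i - w (N + Suc n) i)
              \<le> norm (S (m (?t + k) i) i (w (?t + k)) - S (m (?t + k) i) i (w ?t))
              + \<alpha> * \<sigma> * norm ?D"
            unfolding eq by (rule tri)
          also have "\<dots> \<le> q * b n + \<alpha> * \<sigma> * (real T * (d * R))"
          proof (intro add_mono mult_left_mono)
            show "norm (S (m (?t + k) i) i (w (?t + k)) - S (m (?t + k) i) i (w ?t)) \<le> q * b n"
              by (rule contr[OF i m_nonneg[OF i] m_sum[OF i] bi])
            have "norm ?D \<le> (\<Sum>j=1..T. d * R)"
            proof (rule sum_norm_le)
              fix j assume j: "j \<in> ?I"
              have "\<bar>m (?t + k) i j - m ?t i j\<bar> \<le> d"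
                using N[OF _ i j, of "?t + k"] N[OF _ i j, of ?t] unfolding abs_less_iff abs_le_iff
                by simp
              then show "norm ((m (?t + k) i j - m ?t i j) *\<^sub>R w ?t j) \<le> d * R"
                using wR[OF j] d0 by (simp add: mult_mono)
            qed
            then show "norm ?D \<le> real T * (d * R)" by simp
          qed (use as in simp)
          finally show "norm (w (N + Suc n + k) i - w (N + Suc n) i) \<le> q * b n + e / 2 * (1 - q)"
            unfolding dd .
        qed
        have "b 0 \<le> 2 * R"
          unfolding b_def
        proof (rule MaxE)
          fix i assume "i \<in> ?I"
          then show "norm (w (N + 0 + k) i - w (N + 0) i) \<le> 2 * R"
            using wR[of i "N + k"] wR[of i N] norm_triangle_ineq4[of "w (N + k) i" "w N i"] by simp
        qed
        then have "q ^ n * b 0 \<le> q ^ n * (2 * R)"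
          using q0 by (intro mult_left_mono) auto
        moreover have "b n \<le> q ^ n * b 0 + e / 2 * (1 - q) / (1 - q)"
          using q0 q1 \<open>0 < e\<close> by (intro affine_recurrence_bound b_Suc) auto
        moreover have "e / 2 * (1 - q) / (1 - q) = e / 2"
          using q1 by (intro nonzero_mult_div_cancel_right) simp
        ultimately show ?thesis using bi[OF i, of n] by linarith
      qed
      have "norm (w (s + k) i - w s i) < e" if i: "i \<in> ?I" and s: "N + n0 \<le> s" for i s k
      proof -
        obtain n where "s = N + n" "n0 \<le> n"
          using s by (metis add.assoc le_add1 le_iff_add)
        then show ?thesis using bound[OF i, of n k] n0[of n] by simp
      qed
      then show ?thesis by blast
    qed
    have "Cauchy (\<lambda>t. w t i)" if i: "i \<in> ?I" for i
    proof (rule CauchyI')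
      fix e :: real assume "0 < e"
      then obtain N where "\<forall>s\<ge>N. \<forall>k. norm (w (s + k) i - w s i) < e"
        using cauchy i by blast
      then show "\<exists>M. \<forall>m\<ge>M. \<forall>n>m. dist (w m i) (w n i) < e"
        by (metis dist_commute dist_norm le_add_diff_inverse less_imp_le)
    qed
    then show ?thesis by (simp add: Cauchy_convergent_iff)
  qed
  from part1 part2 show ?thesis
    unfolding a_def c_def W_def G_def q_def by blast
qed

end
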